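(* Let $(X_1,X_2)$ be a bivariate random vector with continuous marginal distribution functions $F_1,F_2$ and copula $C$. Then the Spearman's rho $\rho_C=12\int_0^1\int_0^1C(u,v)\,du\,dv-3$ satisfies $$\rho_C=\rho_{11},\qquad\text{where }\rho_{11}=\mathbb E\big(Q_1(F_1(X_1))\,Q_1(F_2(X_2))\big).$$
   Context: $Q_1(x)=\sqrt3\,(2x-1)$ is the orthonormal shifted Legendre polynomial of degree one on $[0,1]$. The copula $C$ of $(X_1,X_2)$ is the joint distribution function of $(F_1(X_1),F_2(X_2))$ on $[0,1]^2$. *)

theory Defs
  imports "HOL-Probability.Probability"
begin

definition marginal_cdf :: "'a measure \<Rightarrow> ('a \<Rightarrow> real) \<Rightarrow> real \<Rightarrow> real" where
  "marginal_cdf M X = cdf (distr M borel X)"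

definition joint_cdf :: "(real \<times> real) measure \<Rightarrow> real \<Rightarrow> real \<Rightarrow> real" where
  "joint_cdf N u v = measure N ({..u} \<times> {..v})"

text \<open>The copula is used on the unit square only; elsewhere the function below is merely the
  extension of that joint distribution function to the plane.\<close>

definition copula :: "'a measure \<Rightarrow> ('a \<Rightarrow> real) \<Rightarrow> ('a \<Rightarrow> real) \<Rightarrow> real \<Rightarrow> real \<Rightarrow> real" where
  "copula M X\<^sub>1 X\<^sub>2 = joint_cdf
     (distr M borel (\<lambda>\<omega>. (marginal_cdf M X\<^sub>1 (X\<^sub>1 \<omega>), marginal_cdf M X\<^sub>2 (X\<^sub>2 \<omega>))))"

definition spearman_rho :: "(real \<Rightarrow> real \<Rightarrow> real) \<Rightarrow> real" where
  "spearman_rho C =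
     12 * (LINT v:{0..1}|lborel. (LINT u:{0..1}|lborel. C u v)) - 3"

text \<open>The orthonormal shifted Legendre polynomial of degree one on \<open>[0,1]\<close>.\<close>

definition Q\<^sub>1 :: "real \<Rightarrow> real" where
  "Q\<^sub>1 x = sqrt 3 * (2 * x - 1)"

definition rho\<^sub>1\<^sub>1 :: "'a measure \<Rightarrow> ('a \<Rightarrow> real) \<Rightarrow> ('a \<Rightarrow> real) \<Rightarrow> real" where
  "rho\<^sub>1\<^sub>1 M X\<^sub>1 X\<^sub>2 =
     (LINT \<omega>|M. Q\<^sub>1 (marginal_cdf M X\<^sub>1 (X\<^sub>1 \<omega>)) * Q\<^sub>1 (marginal_cdf M X\<^sub>2 (X\<^sub>2 \<omega>)))"

end

theory Submission
  imports Defs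
begin

text \<open>Put \<open>U = F\<^sub>1(X\<^sub>1)\<close> and \<open>V = F\<^sub>2(X\<^sub>2)\<close>. Since \<open>C(u,v)\<close> is the expectation of
  \<open>1[U \<le> u] 1[V \<le> v]\<close>, integrating over \<open>u\<close> and then over \<open>v\<close> gives, by Fubini,
  \<open>\<integral>\<integral> C = E((1 - U)(1 - V))\<close>. Moreover \<open>E U = E V = 1/2\<close>: for \<open>X\<close> and an independent copy
  \<open>X'\<close>, \<open>E F(X) = P(X' \<le> X)\<close>, which by symmetry and absence of atoms is one half. The
  claim is then the expansion of both sides into \<open>12 E(UV) - 3\<close>.\<close>

text \<open>After exchanging the integrals, the inner one measures the set of \<open>u\<close> in
  \<open>{0..1}\<close> with \<open>U x \<le> u\<close>, of length \<open>1 - U x\<close>. The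
  weight \<open>g\<close> lets the lemma be applied twice, once for each variable of the
  copula.\<close>

lemma LINT_unit_interval_expectation_ge:
  fixes U g :: "'a \<Rightarrow> real"
  assumes "sigma_finite_measure M"
    and [measurable]: "U \<in> borel_measurable M"
    and U: "\<And>x. 0 \<le> U x" "\<And>x. U x \<le> 1"
    and g: "integrable M g"
  shows "(LINT u:{0..1}|lborel. (LINT x|M. indicator {U x..} u * g x)) = (LINT x|M. (1 - U x) * g x)"
proof -
  interpret M: sigma_finite_measure M by fact
  interpret P: pair_sigma_finite M "lborel :: real measure" ..
  have gm [measurable]: "g \<in> borel_measurable M"
    using g by auto
  define f where "f x u = indicator {0..1::real} u * (indicator {U x..} u * g x)" for x u
  have f_eq: "f x u = g x * indicator {U x..1} u" for x u
    using U(1)[of x] by (auto simp: f_def indicator_def)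
  have int_f: "(LINT u|lborel. f x u) = (1 - U x) * g x" for x
    unfolding f_eq using U(2)[of x] by simp
  have int_norm_f: "(LINT u|lborel. \<bar>f x u\<bar>) = (1 - U x) * \<bar>g x\<bar>" for x
    unfolding f_eq using U(2)[of x] by (simp add: abs_mult)
  \<comment> \<open>Replacing the indicator of a set that varies with \<open>x\<close> by a
    condition on \<open>x\<close> and \<open>u\<close> makes joint measurability provable
    automatically.\<close>
  have f_alt: "f = (\<lambda>x u. g x * (if U x \<le> u \<and> u \<le> 1 then 1 else 0))"
    by (auto simp: fun_eq_iff f_eq indicator_def)
  have "integrable (M \<Otimes>\<^sub>M lborel) (case_prod f)"
  proof (rule P.Fubini_integrable)
    show "case_prod f \<in> borel_measurable (M \<Otimes>\<^sub>M lborel)"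
      unfolding f_alt by measurable
    show "integrable M (\<lambda>x. LINT u|lborel. norm (case_prod f (x, u)))"
    proof (rule Bochner_Integration.integrable_bound[OF g])
      show "AE x in M. norm (LINT u|lborel. norm (case_prod f (x, u))) \<le> norm (g x)"
        using U by (auto simp: int_norm_f abs_mult intro!: mult_left_le_one_le)
    qed (simp add: int_norm_f)
    show "AE x in M. integrable lborel (\<lambda>u. case_prod f (x, u))"
      using U(2) by (simp add: f_eq integrable_real_indicator)
  qed
  from P.Fubini_integral[OF this]
  have "(LINT u|lborel. (LINT x|M. f x u)) = (LINT x|M. (1 - U x) * g x)"
    by (simp add: int_f)
  then show ?thesis
    by (simp add: f_def set_lebesgue_integral_def)
qed

lemma (in real_distribution) expectation_cdf_no_atoms:
  assumes no_atoms: "\<And>x. measure M {x} = 0"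
  shows "(LINT x|M. cdf M x) = 1 / 2"
proof -
  interpret P: pair_prob_space M M ..
  have meas: "(\<lambda>x. cdf M x) \<in> borel_measurable M"
    using borel_measurable_mono[of "cdf M"] by (simp add: mono_def cdf_nondecreasing)
  have int: "integrable M (cdf M)"
    by (rule integrable_const_bound[of _ 1]) (auto simp: cdf_nonneg cdf_bounded_prob meas)
  \<comment> \<open>Both \<open>{x..}\<close> and the ray behind \<open>cdf M x\<close> contain
    \<open>x\<close>, so their measures add up to 1 only because \<open>x\<close> is not an
    atom.\<close>
  have compl: "measure M {x..} = 1 - cdf M x" for x
  proof -
    have "measure M {x..} = 1 - measure M {..<x}"
      using prob_compl[of "{..<x}"] by (simp add: Compl_lessThan flip: Compl_eq_Diff_UNIV)
    moreover have "cdf M x = measure M {..<x} + measure M {x}"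
      unfolding cdf_def ivl_disj_un_singleton(2)[symmetric] by (rule finite_measure_Union) auto
    ultimately show ?thesis by (simp add: no_atoms)
  qed
  \<comment> \<open>For the event \<open>x \<le> y\<close>, integrating out \<open>x\<close> first
    gives \<open>cdf M y\<close>, while integrating out \<open>y\<close> first gives
    \<open>measure M {x..}\<close>.\<close>
  have "integrable (M \<Otimes>\<^sub>M M) (\<lambda>(x, y). if x \<le> y then 1 else 0 :: real)"
    by (rule P.integrable_const_bound[of _ 1]) auto
  from P.Fubini_integral[OF this]
  have "(LINT y|M. (LINT x|M. indicator {..y} x)) = (LINT x|M. (LINT y|M. indicator {x..} y :: real))"
    by (simp add: indicator_def of_bool_def)
  then have "(LINT y|M. cdf M y) = (LINT x|M. 1 - cdf M x)"
    by (simp add: compl flip: cdf_def)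
  also have "\<dots> = 1 - (LINT x|M. cdf M x)"
    using int by (simp add: prob_space[simplified])
  finally show ?thesis by simp
qed

text \<open>Continuity of the distribution function excludes atoms of the law of \<open>X\<close>; a
  change of variables then carries the mean from that law back to \<open>M\<close>.\<close>

lemma (in prob_space) expectation_marginal_cdf:
  assumes X [measurable]: "X \<in> borel_measurable M"
    and cont: "continuous_on UNIV (marginal_cdf M X)"
  shows "expectation (\<lambda>\<omega>. marginal_cdf M X (X \<omega>)) = 1 / 2"
proof -
  interpret D: real_distribution "distr M borel X"
    by (rule real_distribution_distr) fact
  have "measure (distr M borel X) {x} = 0" for x
    using cont D.isCont_cdf[of x] by (simp add: marginal_cdf_def continuous_on_eq_continuous_at)
  then have "(LINT x|distr M borel X. cdf (distr M borel X) x) = 1 / 2"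
    by (rule D.expectation_cdf_no_atoms)
  then show ?thesis
    using cont by (simp add: marginal_cdf_def integral_distr borel_measurable_continuous_onI)
qed

theorem proposition4:
  fixes M :: "'a measure" and X\<^sub>1 X\<^sub>2 :: "'a \<Rightarrow> real"
  assumes "prob_space M"
    and "X\<^sub>1 \<in> borel_measurable M" and "X\<^sub>2 \<in> borel_measurable M"
    and "continuous_on UNIV (marginal_cdf M X\<^sub>1)"
    and "continuous_on UNIV (marginal_cdf M X\<^sub>2)"
  shows "spearman_rho (copula M X\<^sub>1 X\<^sub>2) = rho\<^sub>1\<^sub>1 M X\<^sub>1 X\<^sub>2"
proof -
  interpret prob_space M by fact
  define U where "U \<omega> = marginal_cdf M X\<^sub>1 (X\<^sub>1 \<omega>)" for \<omega>
  define V where "V \<omega> = marginal_cdf M X\<^sub>2 (X\<^sub>2 \<omega>)" for \<omega>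
  have [measurable]: "U \<in> borel_measurable M" "V \<in> borel_measurable M"
    unfolding U_def V_def using assms
    by (auto intro: measurable_compose borel_measurable_continuous_onI)
  have U: "0 \<le> U \<omega>" "U \<omega> \<le> 1" and V: "0 \<le> V \<omega>" "V \<omega> \<le> 1" for \<omega>
    using assms(2,3)
    by (auto simp: U_def V_def marginal_cdf_def real_distribution_distr
      intro: finite_borel_measure.cdf_nonneg real_distribution.cdf_bounded_prob
        real_distribution.finite_borel_measure_M)
  have int: "integrable M U" "integrable M V" "integrable M (\<lambda>\<omega>. U \<omega> * V \<omega>)"
    using U V by (auto intro!: integrable_const_bound[of _ 1] AE_I2 mult_le_one)
  have EU: "expectation U = 1 / 2" and EV: "expectation V = 1 / 2"
    unfolding U_def V_def using assms by (simp_all only: expectation_marginal_cdf)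
  have C: "copula M X\<^sub>1 X\<^sub>2 u v = (LINT \<omega>|M. indicator {U \<omega>..} u * indicator {V \<omega>..} v)" for u v
  proof -
    have "copula M X\<^sub>1 X\<^sub>2 u v = measure M ((\<lambda>\<omega>. (U \<omega>, V \<omega>)) -` ({..u} \<times> {..v}) \<inter> space M)"
      unfolding copula_def joint_cdf_def U_def[symmetric] V_def[symmetric]
      by (rule measure_distr) (auto simp: borel_prod[symmetric])
    also have "\<dots> = (LINT \<omega>|M. indicator ((\<lambda>\<omega>. (U \<omega>, V \<omega>)) -` ({..u} \<times> {..v}) \<inter> space M) \<omega>)"
      by simp
    also have "\<dots> = (LINT \<omega>|M. indicator {U \<omega>..} u * indicator {V \<omega>..} v)"
      by (intro Bochner_Integration.integral_cong) (auto simp: indicator_def)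
    finally show ?thesis .
  qed
  \<comment> \<open>First integration: \<open>v\<close> is fixed and the weight is the indicator of
    \<open>V \<omega> \<le> v\<close>.\<close>
  have "(LINT u:{0..1}|lborel. copula M X\<^sub>1 X\<^sub>2 u v) = (LINT \<omega>|M. indicator {V \<omega>..} v * (1 - U \<omega>))" for v
  proof -
    have "integrable M (\<lambda>\<omega>. if V \<omega> \<le> v then 1 else 0 :: real)"
      by (rule integrable_const_bound[of _ 1]) auto
    then have "integrable M (\<lambda>\<omega>. indicator {V \<omega>..} v :: real)"
      by (simp add: indicator_def of_bool_def)
    then show ?thesis
      unfolding C using U
      by (subst LINT_unit_interval_expectation_ge) (auto simp: mult.commute sigma_finite_measure_axioms)
  qed
  then have "(LINT v:{0..1}|lborel. (LINT u:{0..1}|lborel. copula M X\<^sub>1 X\<^sub>2 u v))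
      = (LINT v:{0..1}|lborel. (LINT \<omega>|M. indicator {V \<omega>..} v * (1 - U \<omega>)))"
    by simp
  \<comment> \<open>Second integration: \<open>V\<close> takes the role of \<open>U\<close>, and the
    weight is the factor \<open>1 - U \<omega>\<close> left by the first.\<close>
  also have "\<dots> = (LINT \<omega>|M. (1 - V \<omega>) * (1 - U \<omega>))"
    using V int by (intro LINT_unit_interval_expectation_ge) (auto simp: sigma_finite_measure_axioms)
  also have "\<dots> = (LINT \<omega>|M. 1 - U \<omega> - V \<omega> + U \<omega> * V \<omega>)"
    by (simp add: algebra_simps)
  also have "\<dots> = (LINT \<omega>|M. U \<omega> * V \<omega>)"
    using int by (simp add: EU EV prob_space)
  finally have "spearman_rho (copula M X\<^sub>1 X\<^sub>2) = 12 * (LINT \<omega>|M. U \<omega> * V \<omega>) - 3"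
    by (simp add: spearman_rho_def)
  \<comment> \<open>This expands \<open>3 * (2 * U \<omega> - 1) * (2 * V \<omega> - 1)\<close>;
    with both means equal to 1/2, the lower-order terms contribute 3 - 3 - 3 = -3.\<close>
  moreover have "rho\<^sub>1\<^sub>1 M X\<^sub>1 X\<^sub>2 = (LINT \<omega>|M. 12 * (U \<omega> * V \<omega>) - 6 * U \<omega> - 6 * V \<omega> + 3)"
    unfolding rho\<^sub>1\<^sub>1_def Q\<^sub>1_def U_def[symmetric] V_def[symmetric]
    by (intro Bochner_Integration.integral_cong) (auto simp: algebra_simps)
  moreover have "\<dots> = 12 * (LINT \<omega>|M. U \<omega> * V \<omega>) - 3"
    using int by (simp add: EU EV prob_space)
  ultimately show ?thesis by simp
qed

end
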